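(* Let $\kappa$ be a supercompact cardinal. Then every reflexive abelian group $H$ of cardinality $\geq \kappa$ has arbitrarily large direct summands of cardinality $< \kappa$; that is, for every cardinal $\chi < \kappa$ there is a direct summand $H'$ of $H$ with $\chi \leq |H'| < \kappa$.
   Context: For an abelian group $G$, $G^* = \operatorname{Hom}(G,\mathbb{Z})$ denotes its dual group. $G$ is reflexive if the evaluation map $\sigma : G \to G^{**}$, $\sigma(g)(\varphi) = \varphi(g)$ for $\varphi\in G^*$, is an isomorphism. *)

theory Defs
  imports "HOL-Algebra.Elementary_Groups"
begin

unbundle cardinal_syntax

text \<open>
  HOL has no quantifier over types, so ``every set'' needs a carrier. A type \<open>'v\<close>
  stands in for the universe of sets: the sets of the universe are, up to bijection, the
  subsets of \<open>'v\<close> of cardinality less than that of \<open>'v\<close> itself. Only closure under power sets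
  is required (\<open>'v\<close> has strong limit cardinality); this holds for every Grothendieck universe,
  but also, in ZFC, for types of arbitrarily large cardinality.
\<close>

definition small :: "'v itself \<Rightarrow> 'a set \<Rightarrow> bool" where
  "small (_ :: 'v itself) A \<longleftrightarrow> |A| <o |UNIV :: 'v set|"

definition set_universe :: "'v itself \<Rightarrow> bool" where
  "set_universe V \<longleftrightarrow> (\<forall>A :: 'v set. small V A \<longrightarrow> small V (Pow A))"

text \<open>Cardinals are represented, as in the library, by well-orders \<open>\<kappa>\<close> with \<open>Card_order \<kappa>\<close>.
  The set \<open>P\<^sub>\<kappa>(A)\<close> of subsets of \<open>A\<close> of cardinality less than \<open>\<kappa>\<close>:\<close>

definition Pow_less :: "'k rel \<Rightarrow> 'v set \<Rightarrow> 'v set set" where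
  "Pow_less \<kappa> A = {P. P \<subseteq> A \<and> |P| <o \<kappa>}"

text \<open>
  A normal measure on \<open>P\<^sub>\<kappa>(A)\<close> is a \<open>\<kappa>\<close>-complete ultrafilter that is fine (it contains every
  \<open>{P. a \<in> P}\<close> with \<open>a \<in> A\<close>) and such that every choice function is constant on a set of the
  ultrafilter. It is represented by a filter on all sets that concentrates on \<open>P\<^sub>\<kappa>(A)\<close>; a set
  \<open>X\<close> belongs to the ultrafilter iff \<open>\<forall>\<^sub>F P in F. P \<in> X\<close>.
\<close>

definition normal_measure :: "'k rel \<Rightarrow> 'v set \<Rightarrow> 'v set filter \<Rightarrow> bool" where
  "normal_measure \<kappa> A F \<longleftrightarrow>
     F \<noteq> bot \<and>
     (\<forall>\<^sub>F P in F. P \<in> Pow_less \<kappa> A) \<and>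
     (\<forall>X. (\<forall>\<^sub>F P in F. P \<in> X) \<or> (\<forall>\<^sub>F P in F. P \<notin> X)) \<and>
     (\<forall>\<X> :: 'v set set set. |\<X>| <o \<kappa> \<longrightarrow> (\<forall>X\<in>\<X>. \<forall>\<^sub>F P in F. P \<in> X) \<longrightarrow>
        (\<forall>\<^sub>F P in F. P \<in> \<Inter>\<X>)) \<and>
     (\<forall>a\<in>A. \<forall>\<^sub>F P in F. a \<in> P) \<and>
     (\<forall>f. (\<forall>\<^sub>F P in F. f P \<in> P) \<longrightarrow> (\<exists>a. \<forall>\<^sub>F P in F. f P = a))"

text \<open>
  An uncountable cardinal \<open>\<kappa>\<close> is supercompact if \<open>P\<^sub>\<kappa>(A)\<close> carries a normal measure for every
  set \<open>A\<close> with \<open>|A| \<ge> \<kappa>\<close> (Solovay--Reinhardt; Jech, Set Theory, Chapter 20). Here \<open>\<kappa>\<close> is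
  required to be a cardinal of the universe and \<open>A\<close> ranges over the sets of the universe.
\<close>

definition supercompact :: "'v itself \<Rightarrow> 'k rel \<Rightarrow> bool" where
  "supercompact V \<kappa> \<longleftrightarrow>
     Card_order \<kappa> \<and> natLeq <o \<kappa> \<and> small V (Field \<kappa>) \<and>
     (\<forall>A :: 'v set. small V A \<longrightarrow> \<kappa> \<le>o |A| \<longrightarrow> (\<exists>F. normal_measure \<kappa> A F))"

text \<open>
  The dual group \<open>Hom(G, \<int>)\<close> with pointwise addition. Homomorphisms are made extensional,
  since \<^const>\<open>hom\<close> leaves the values outside the carrier arbitrary.
\<close>

definition dual :: "('a, 'b) monoid_scheme \<Rightarrow> ('a \<Rightarrow> int) monoid" where
  "dual G = \<lparr>carrier = hom G integer_group \<inter> extensional (carrier G),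
             monoid.mult = (\<lambda>\<phi> \<psi>. \<lambda>x\<in>carrier G. \<phi> x + \<psi> x),
             one = (\<lambda>x\<in>carrier G. 0)\<rparr>"

definition evaluation :: "('a, 'b) monoid_scheme \<Rightarrow> 'a \<Rightarrow> ('a \<Rightarrow> int) \<Rightarrow> int" where
  "evaluation G g = (\<lambda>\<phi>\<in>carrier (dual G). \<phi> g)"

definition reflexive :: "('a, 'b) monoid_scheme \<Rightarrow> bool" where
  "reflexive G \<longleftrightarrow> evaluation G \<in> iso G (dual (dual G))"

definition direct_summand :: "'a set \<Rightarrow> ('a, 'b) monoid_scheme \<Rightarrow> bool" where
  "direct_summand S G \<longleftrightarrow> subgroup S G \<and>
     (\<exists>T. subgroup T G \<and> S \<inter> T = {\<one>\<^bsub>G\<^esub>} \<and> S <#>\<^bsub>G\<^esub> T = carrier G)"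

end

theory Submission
  imports Defs "HOL-Library.Countable"
begin

text \<open>
  Fix a normal measure on \<open>P\<^sub>\<kappa>(H + H\<^sup>*)\<close>. For almost every \<open>P\<close>, the set \<open>S = P \<inter> H\<close> is a
  subgroup and \<open>\<Phi> = P \<inter> H\<^sup>*\<close> separates its points. If \<open>y\<^sub>P \<in> H\<close> is chosen for each \<open>P\<close>, then
  sending \<open>\<phi> \<in> H\<^sup>*\<close> to the almost everywhere constant value of \<open>\<phi> (y\<^sub>P)\<close> is a homomorphism
  \<open>H\<^sup>* \<rightarrow> \<int>\<close>, hence evaluation at some \<open>h \<in> H\<close> by reflexivity. By normality, \<open>y\<^sub>P\<close> and \<open>h\<close> agree
  on \<open>P \<inter> H\<^sup>*\<close> for almost every \<open>P\<close>. Consequently, for almost every \<open>P\<close>, each \<open>y \<in> H\<close> agrees on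
  \<open>\<Phi>\<close> with a (unique) element of \<open>S\<close>, so that the common kernel of \<open>\<Phi>\<close> is a complement of \<open>S\<close>.
  This is the projection \<open>j(H) \<rightarrow> j[H]\<close> of the ultrapower embedding \<open>j\<close>, in combinatorial form.
\<close>

section \<open>Normal measures: completeness, diagonal intersections, transport along
  injections\<close>

lemma normal_measureD:
  assumes "normal_measure \<kappa> A F"
  shows normal_measure_neq_bot: "F \<noteq> bot"
    and normal_measure_Pow_less: "\<forall>\<^sub>F P in F. P \<in> Pow_less \<kappa> A"
    and normal_measure_ultra: "\<not> (\<forall>\<^sub>F P in F. R P) \<Longrightarrow> \<forall>\<^sub>F P in F. \<not> R P"
    and normal_measure_fine: "a \<in> A \<Longrightarrow> \<forall>\<^sub>F P in F. a \<in> P"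
    and normal_measure_choice: "\<forall>\<^sub>F P in F. f P \<in> P \<Longrightarrow> \<exists>a. \<forall>\<^sub>F P in F. f P = a"
proof -
  have "(\<forall>\<^sub>F P in F. P \<in> {P. R P}) \<or> (\<forall>\<^sub>F P in F. P \<notin> {P. R P})"
    using assms unfolding normal_measure_def by blast
  then show "\<not> (\<forall>\<^sub>F P in F. R P) \<Longrightarrow> \<forall>\<^sub>F P in F. \<not> R P" by simp
qed (use assms in \<open>auto simp: normal_measure_def\<close>)

lemma normal_measure_complete:
  assumes "normal_measure \<kappa> A F" and "|I| <o \<kappa>" and "\<And>i. i \<in> I \<Longrightarrow> \<forall>\<^sub>F P in F. R i P"
  shows "\<forall>\<^sub>F P in F. \<forall>i\<in>I. R i P"
proof -
  let ?X = "(\<lambda>i. {P. R i P}) ` I"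
  have "|?X| <o \<kappa>"
    using card_of_image assms(2) by (rule ordLeq_ordLess_trans)
  moreover have "\<forall>X\<in>?X. \<forall>\<^sub>F P in F. P \<in> X"
    using assms(3) by auto
  ultimately have "\<forall>\<^sub>F P in F. P \<in> \<Inter>?X"
    using assms(1) unfolding normal_measure_def by blast
  then show ?thesis by simp
qed

lemma eventually_choice:
  assumes "\<forall>\<^sub>F x in F. \<exists>y. R x y"
  obtains f where "\<forall>\<^sub>F x in F. R x (f x)"
proof -
  have "\<forall>\<^sub>F x in F. R x (SOME y. R x y)"
    using assms by eventually_elim (rule someI_ex)
  then show thesis by (rule that)
qed

text \<open>Closure under diagonal intersections. If almost every P contained an element violating
  \<open>R\<close>, choosing one would give a choice function; by normality it is almost everywhere
  a single a, against \<open>R\<close> holding almost everywhere for that a.\<close>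

lemma normal_measure_diagonal:
  assumes F: "normal_measure \<kappa> A F" and R: "\<And>a. a \<in> A \<Longrightarrow> \<forall>\<^sub>F P in F. R a P"
  shows "\<forall>\<^sub>F P in F. \<forall>a\<in>P. R a P"
proof (rule ccontr)
  assume "\<not> ?thesis"
  from normal_measure_ultra[OF F this] have "\<forall>\<^sub>F P in F. \<exists>a. a \<in> P \<and> \<not> R a P"
    by eventually_elim blast
  then obtain f where f: "\<forall>\<^sub>F P in F. f P \<in> P \<and> \<not> R (f P) P"
    by (rule eventually_choice)
  then have "\<forall>\<^sub>F P in F. f P \<in> P"
    by eventually_elim blast
  then obtain a where a: "\<forall>\<^sub>F P in F. f P = a"
    using normal_measure_choice[OF F, of f] by blast
  have bad: "\<forall>\<^sub>F P in F. a \<in> A \<and> \<not> R a P"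
    using f a normal_measure_Pow_less[OF F] by eventually_elim (auto simp: Pow_less_def)
  \<comment> \<open>The statement does not mention P, so holding eventually in a proper filter makes
    it true.\<close>
  then have "a \<in> A"
    using normal_measure_neq_bot[OF F] by (simp add: eventually_conj_iff)
  from R[OF this] bad have "\<forall>\<^sub>F P in F. False"
    by eventually_elim blast
  then show False
    using normal_measure_neq_bot[OF F] by (simp add: eventually_False)
qed

text \<open>If each value were avoided almost everywhere, \<kappa>-completeness with \<kappa>
  uncountable would let f avoid all countably many values at once. It is applied to integer values
  below.\<close>

lemma normal_measure_countable_const:
  fixes f :: "'x set \<Rightarrow> 'i :: countable"
  assumes F: "normal_measure \<kappa> A F" and "natLeq <o \<kappa>"
  shows "\<exists>n. \<forall>\<^sub>F P in F. f P = n"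
proof (rule ccontr)
  assume "\<not> ?thesis"
  then have "\<forall>\<^sub>F P in F. f P \<noteq> n" for n
    using normal_measure_ultra[OF F] by blast
  moreover have "|UNIV :: 'i set| <o \<kappa>"
    using assms(2) card_of_ordLeqI[of to_nat "UNIV :: 'i set" "UNIV :: nat set"] card_of_nat
    by (metis UNIV_I inj_to_nat ordLeq_ordIso_trans ordLeq_ordLess_trans)
  ultimately have "\<forall>\<^sub>F P in F. \<forall>n\<in>UNIV. f P \<noteq> n"
    by (intro normal_measure_complete[OF F])
  then show False
    using normal_measure_neq_bot[OF F] by (simp add: eventually_False)
qed

text \<open>The measure is pushed forward along Q \<mapsto> preimage of Q in A. For normality, e
  turns a choice function on the preimages into one on the sets Q, and its constant value is carried
  back by the inverse of e.\<close>

lemma normal_measure_pullback: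
  assumes F: "normal_measure \<kappa> (e ` A) F" and e: "inj_on e A"
  shows "normal_measure \<kappa> A (filtermap (\<lambda>Q. {x \<in> A. e x \<in> Q}) F)"
proof -
  define r where "r Q = {x \<in> A. e x \<in> Q}" for Q
  have "r Q \<in> Pow_less \<kappa> A" if "Q \<in> Pow_less \<kappa> (e ` A)" for Q
  proof -
    have "|r Q| \<le>o |Q|"
      using e by (intro card_of_ordLeqI[of e]) (auto simp: r_def inj_on_def)
    then show ?thesis
      using that ordLeq_ordLess_trans by (auto simp: Pow_less_def r_def)
  qed
  then have "\<forall>\<^sub>F Q in F. r Q \<in> Pow_less \<kappa> A"
    using normal_measure_Pow_less[OF F] by (rule eventually_mono[rotated])
  moreover have "(\<forall>\<^sub>F Q in F. r Q \<in> X) \<or> (\<forall>\<^sub>F Q in F. r Q \<notin> X)" for X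
    using normal_measure_ultra[OF F] by blast
  moreover have "\<forall>\<^sub>F Q in F. r Q \<in> \<Inter>\<X>"
    if "|\<X>| <o \<kappa>" "\<forall>X\<in>\<X>. \<forall>\<^sub>F Q in F. r Q \<in> X" for \<X>
    using normal_measure_complete[OF F that(1), of "\<lambda>X Q. r Q \<in> X"] that(2) by simp
  moreover have "\<forall>\<^sub>F Q in F. a \<in> r Q" if "a \<in> A" for a
    using normal_measure_fine[OF F, of "e a"] that by (simp add: r_def)
  moreover have "\<exists>a. \<forall>\<^sub>F Q in F. f (r Q) = a" if f: "\<forall>\<^sub>F Q in F. f (r Q) \<in> r Q" for f
  proof -
    have "\<forall>\<^sub>F Q in F. e (f (r Q)) \<in> Q"
      using f by eventually_elim (simp add: r_def)
    then obtain b where "\<forall>\<^sub>F Q in F. e (f (r Q)) = b"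
      using normal_measure_choice[OF F, of "\<lambda>Q. e (f (r Q))"] by blast
    with f have "\<forall>\<^sub>F Q in F. f (r Q) = inv_into A e b"
      by eventually_elim (use e in \<open>auto simp: r_def\<close>)
    then show ?thesis ..
  qed
  ultimately show ?thesis
    using normal_measure_neq_bot[OF F]
    unfolding normal_measure_def r_def[symmetric] eventually_filtermap filtermap_bot_iff
    by blast
qed

text \<open>Supercompactness provides measures only over subsets of \<open>'v\<close>, while the
  group and its dual have other types. Smallness supplies an injection into \<open>'v\<close> along
  which the measure is pulled back.\<close>

lemma supercompact_normal_measure:
  fixes A :: "'x set"
  assumes "supercompact TYPE('v) \<kappa>" and "small TYPE('v) A" and "\<kappa> \<le>o |A|"
  shows "\<exists>F. normal_measure \<kappa> A F"
proof -
  obtain e :: "'x \<Rightarrow> 'v" where e: "inj_on e A"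
    using assms(2) card_of_ordLeq[of A "UNIV :: 'v set"] unfolding small_def
    by (meson ordLess_imp_ordLeq)
  then have iso: "|A| =o |e ` A|"
    by (meson card_of_ordIso bij_betw_imageI)
  then have "small TYPE('v) (e ` A)"
    using assms(2) unfolding small_def by (meson ordIso_ordLess_trans ordIso_symmetric)
  moreover have "\<kappa> \<le>o |e ` A|"
    using assms(3) iso by (rule ordLeq_ordIso_trans)
  ultimately obtain F where "normal_measure \<kappa> (e ` A) F"
    using assms(1) unfolding supercompact_def by blast
  with e show ?thesis
    by (blast intro: normal_measure_pullback)
qed

section \<open>Smallness of power sets and of the dual group\<close>

lemma card_of_Pow_mono:
  assumes "|A| \<le>o |B|"
  shows "|Pow A| \<le>o |Pow B|"
proof -
  obtain e where "inj_on e A" "e ` A \<subseteq> B"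
    using assms card_of_ordLeq[of A B] by blast
  then show ?thesis
    by (intro card_of_ordLeqI[of "image e"]) (auto intro: inj_on_image_Pow)
qed

lemma small_mono: "|A| \<le>o |B| \<Longrightarrow> small V B \<Longrightarrow> small V A"
  unfolding small_def by (rule ordLeq_ordLess_trans)

lemma small_Pow:
  fixes A :: "'x set"
  assumes "set_universe TYPE('v)" and "small TYPE('v) A"
  shows "small TYPE('v) (Pow A)"
proof -
  obtain e :: "'x \<Rightarrow> 'v" where e: "inj_on e A"
    using assms(2) card_of_ordLeq[of A "UNIV :: 'v set"] unfolding small_def
    by (meson ordLess_imp_ordLeq)
  have "small TYPE('v) (e ` A)"
    using card_of_image assms(2) by (rule small_mono)
  then have "small TYPE('v) (Pow (e ` A))"
    using assms(1) unfolding set_universe_def by blast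
  moreover have "|A| \<le>o |e ` A|"
    using e by (intro card_of_ordLeqI[of e]) auto
  then have "|Pow A| \<le>o |Pow (e ` A)|"
    by (rule card_of_Pow_mono)
  ultimately show ?thesis
    using small_mono by blast
qed

lemma hom_integer_group_mult:
  "\<phi> \<in> hom G integer_group \<Longrightarrow> x \<in> carrier G \<Longrightarrow> y \<in> carrier G \<Longrightarrow> \<phi> (x \<otimes>\<^bsub>G\<^esub> y) = \<phi> x + \<phi> y"
  by (simp add: hom_def integer_group_def)

text \<open>An extensional homomorphism is determined by its graph, a subset of G \<times> \<int>,
  and this product is no larger than the infinite group G.\<close>

lemma card_carrier_dual:
  assumes "infinite (carrier G)"
  shows "|carrier (dual G)| \<le>o |Pow (carrier G)|"
proof -
  let ?gr = "\<lambda>\<phi> :: 'a \<Rightarrow> int. {(x, \<phi> x) |x. x \<in> carrier G}"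
  have "inj_on ?gr (carrier (dual G))"
  proof (rule inj_onI)
    fix \<phi> \<psi> assume "\<phi> \<in> carrier (dual G)" "\<psi> \<in> carrier (dual G)" and eq: "?gr \<phi> = ?gr \<psi>"
    then have "\<phi> \<in> extensional (carrier G)" "\<psi> \<in> extensional (carrier G)"
      by (simp_all add: dual_def)
    moreover have "\<phi> x = \<psi> x" if "x \<in> carrier G" for x
      using eq that by blast
    ultimately show "\<phi> = \<psi>" by (rule extensionalityI)
  qed
  then have 1: "|carrier (dual G)| \<le>o |Pow (carrier G \<times> (UNIV :: int set))|"
    by (rule card_of_ordLeqI) auto
  have "|UNIV :: int set| \<le>o |carrier G|"
    using assms card_of_ordLeqI[of to_nat "UNIV :: int set" "UNIV :: nat set"]
    by (metis UNIV_I infinite_iff_card_of_nat inj_to_nat ordLeq_transitive)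
  then have "|carrier G \<times> (UNIV :: int set)| \<le>o |carrier G|"
    using assms by (blast intro: ordIso_imp_ordLeq card_of_Times_infinite_simps(1))
  then have "|Pow (carrier G \<times> (UNIV :: int set))| \<le>o |Pow (carrier G)|"
    by (rule card_of_Pow_mono)
  with 1 show ?thesis
    by (rule ordLeq_transitive)
qed

section \<open>Complements from homomorphisms, and the two halves of reflexivity\<close>

lemma direct_summand_of_homs:
  assumes "group H" and S: "subgroup S H" and \<Phi>: "\<Phi> \<subseteq> hom H integer_group"
    and sep: "\<And>h. h \<in> S \<Longrightarrow> h \<noteq> \<one>\<^bsub>H\<^esub> \<Longrightarrow> \<exists>\<phi>\<in>\<Phi>. \<phi> h \<noteq> 0"
    and rep: "\<And>y. y \<in> carrier H \<Longrightarrow> \<exists>h\<in>S. \<forall>\<phi>\<in>\<Phi>. \<phi> h = \<phi> y"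
  shows "direct_summand S H"
proof -
  interpret group H by fact
  \<comment> \<open>The complement is the common kernel of \<Phi>: \<open>sep\<close> makes its
    intersection with S trivial, and \<open>rep\<close> moves any y into it by an element of
    S.\<close>
  define T where "T = {t \<in> carrier H. \<forall>\<phi>\<in>\<Phi>. \<phi> t = 0}"
  have \<phi>: "group_hom H integer_group \<phi>" if "\<phi> \<in> \<Phi>" for \<phi>
    using that \<Phi> by (auto simp: group_hom_def group_hom_axioms_def)
  have one: "\<phi> \<one>\<^bsub>H\<^esub> = 0" if "\<phi> \<in> \<Phi>" for \<phi>
    using group_hom.hom_one[OF \<phi>[OF that]] by simp
  have inv: "\<phi> (inv\<^bsub>H\<^esub> x) = - \<phi> x" if "\<phi> \<in> \<Phi>" "x \<in> carrier H" for \<phi> x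
    using group_hom.hom_inv[OF \<phi>[OF that(1)] that(2)] by simp
  have mult: "\<phi> (x \<otimes>\<^bsub>H\<^esub> y) = \<phi> x + \<phi> y"
    if "\<phi> \<in> \<Phi>" "x \<in> carrier H" "y \<in> carrier H" for \<phi> x y
    using hom_integer_group_mult[OF subsetD[OF \<Phi> that(1)] that(2,3)] .
  have "subgroup T H"
  proof (rule subgroupI)
    show "T \<noteq> {}"
      using one unfolding T_def by blast
    show "inv\<^bsub>H\<^esub> a \<in> T" if "a \<in> T" for a
      using that inv[of _ a] unfolding T_def by fastforce
    show "a \<otimes>\<^bsub>H\<^esub> b \<in> T" if "a \<in> T" "b \<in> T" for a b
      using that mult[of _ a b] unfolding T_def by fastforce
  qed (auto simp: T_def)
  moreover have "S \<inter> T = {\<one>\<^bsub>H\<^esub>}"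
    using sep one subgroup.one_closed[OF S] unfolding T_def by blast
  moreover have "S <#>\<^bsub>H\<^esub> T = carrier H"
  proof
    show "S <#>\<^bsub>H\<^esub> T \<subseteq> carrier H"
      using subgroup.subset[OF S] by (intro set_mult_closed) (auto simp: T_def)
    show "carrier H \<subseteq> S <#>\<^bsub>H\<^esub> T"
    proof
      fix y assume y: "y \<in> carrier H"
      then obtain h where h: "h \<in> S" "\<forall>\<phi>\<in>\<Phi>. \<phi> h = \<phi> y"
        using rep by blast
      have hH: "h \<in> carrier H"
        using subgroup.subset[OF S] h(1) by blast
      have "inv\<^bsub>H\<^esub> h \<otimes>\<^bsub>H\<^esub> y \<in> T"
        using y h(2) hH inv[of _ h] mult[of _ "inv\<^bsub>H\<^esub> h" y] unfolding T_def by fastforce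
      moreover have "y = h \<otimes>\<^bsub>H\<^esub> (inv\<^bsub>H\<^esub> h \<otimes>\<^bsub>H\<^esub> y)"
        using y hH by (simp add: m_assoc[symmetric])
      ultimately show "y \<in> S <#>\<^bsub>H\<^esub> T"
        using h(1) unfolding set_mult_def by blast
    qed
  qed
  ultimately show ?thesis
    using S unfolding direct_summand_def by blast
qed

text \<open>This is injectivity of the evaluation map, applied to h and the identity.\<close>

lemma reflexive_separates:
  assumes "group H" and "reflexive H" and "h \<in> carrier H" and "h \<noteq> \<one>\<^bsub>H\<^esub>"
  shows "\<exists>\<phi>\<in>carrier (dual H). \<phi> h \<noteq> 0"
proof -
  interpret group H by fact
  have "inj_on (evaluation H) (carrier H)"
    using assms(2) by (auto simp: reflexive_def iso_def bij_betw_def)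
  then have "evaluation H h \<noteq> evaluation H \<one>\<^bsub>H\<^esub>"
    using assms(3,4) by (auto dest: inj_onD)
  then obtain \<phi> where \<phi>: "\<phi> \<in> carrier (dual H)" "\<phi> h \<noteq> \<phi> \<one>\<^bsub>H\<^esub>"
    unfolding evaluation_def by (meson restrict_ext)
  have "\<phi> \<one>\<^bsub>H\<^esub> = 0"
    using \<phi>(1) hom_one[OF _ group_axioms group_integer_group, of \<phi>] by (simp add: dual_def)
  with \<phi> show ?thesis by auto
qed

text \<open>This is surjectivity of the evaluation map: v, cut down to an extensional function, is
  an element of the double dual.\<close>

lemma reflexive_represents:
  assumes "group H" and "reflexive H"
    and add: "\<And>\<phi> \<psi>. \<phi> \<in> carrier (dual H) \<Longrightarrow> \<psi> \<in> carrier (dual H) \<Longrightarrow>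
      v (\<phi> \<otimes>\<^bsub>dual H\<^esub> \<psi>) = v \<phi> + v \<psi>"
  shows "\<exists>h\<in>carrier H. \<forall>\<phi>\<in>carrier (dual H). \<phi> h = v \<phi>"
proof -
  interpret group H by fact
  have "\<phi> \<otimes>\<^bsub>dual H\<^esub> \<psi> \<in> carrier (dual H)"
    if "\<phi> \<in> carrier (dual H)" "\<psi> \<in> carrier (dual H)" for \<phi> \<psi>
    using that by (auto simp: dual_def hom_def integer_group_def)
  then have "restrict v (carrier (dual H)) \<in> hom (dual H) integer_group"
    using add by (intro homI) (auto simp: integer_group_def)
  then have "restrict v (carrier (dual H)) \<in> carrier (dual (dual H))"
    by (simp add: dual_def[of "dual H"])
  moreover have "evaluation H ` carrier H = carrier (dual (dual H))"
    using assms(2) by (auto simp: reflexive_def iso_def bij_betw_def)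
  ultimately obtain h where h: "h \<in> carrier H" "restrict v (carrier (dual H)) = evaluation H h"
    by auto
  have "\<phi> h = v \<phi>" if "\<phi> \<in> carrier (dual H)" for \<phi>
    using fun_cong[OF h(2), of \<phi>] that by (simp add: evaluation_def)
  with h(1) show ?thesis by blast
qed

section \<open>Almost every P cuts out a direct summand\<close>

lemma normal_measure_reflexive_summand:
  assumes "group H" and "reflexive H" and "natLeq <o \<kappa>"
    and F: "normal_measure \<kappa> (carrier H <+> carrier (dual H)) F"
  shows "\<forall>\<^sub>F P in F. direct_summand (Inl -` P) H"
proof -
  interpret group H by fact
  let ?A = "carrier H <+> carrier (dual H)"
  have fineH: "\<forall>\<^sub>F P in F. Inl h \<in> P" if "h \<in> carrier H" for h
    using normal_measure_fine[OF F] that by blast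
  have fineD: "\<forall>\<^sub>F P in F. Inr \<phi> \<in> P" if "\<phi> \<in> carrier (dual H)" for \<phi>
    using normal_measure_fine[OF F] that by blast
  \<comment> \<open>Diagonal intersection, split according to the two halves of the disjoint union
    \<open>?A\<close>.\<close>
  have diagH: "\<forall>\<^sub>F P in F. \<forall>h\<in>Inl -` P. R h P"
    if "\<And>h. h \<in> carrier H \<Longrightarrow> \<forall>\<^sub>F P in F. R h P" for R
  proof -
    have "\<forall>\<^sub>F P in F. \<forall>a\<in>P. \<forall>h. a = Inl h \<longrightarrow> R h P"
      using that by (intro normal_measure_diagonal[OF F]) auto
    then show ?thesis by eventually_elim auto
  qed
  have diagD: "\<forall>\<^sub>F P in F. \<forall>\<phi>\<in>Inr -` P. R \<phi> P"
    if "\<And>\<phi>. \<phi> \<in> carrier (dual H) \<Longrightarrow> \<forall>\<^sub>F P in F. R \<phi> P" for R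
  proof -
    have "\<forall>\<^sub>F P in F. \<forall>a\<in>P. \<forall>\<phi>. a = Inr \<phi> \<longrightarrow> R \<phi> P"
      using that by (intro normal_measure_diagonal[OF F]) auto
    then show ?thesis by eventually_elim auto
  qed
  have sub: "\<forall>\<^sub>F P in F. P \<subseteq> ?A"
    using normal_measure_Pow_less[OF F] by eventually_elim (auto simp: Pow_less_def)
  have mult: "\<forall>\<^sub>F P in F. \<forall>x\<in>Inl -` P. \<forall>y\<in>Inl -` P. Inl (x \<otimes>\<^bsub>H\<^esub> y) \<in> P"
    by (intro diagH fineH m_closed)
  have inv: "\<forall>\<^sub>F P in F. \<forall>x\<in>Inl -` P. Inl (inv\<^bsub>H\<^esub> x) \<in> P"
    by (intro diagH fineH inv_closed)
  \<comment> \<open>For a fixed h one separating \<phi> suffices: by fineness it lies in almost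
    every P.\<close>
  have sep: "\<forall>\<^sub>F P in F. \<forall>h\<in>Inl -` P. h \<noteq> \<one>\<^bsub>H\<^esub> \<longrightarrow> (\<exists>\<phi>\<in>Inr -` P. \<phi> h \<noteq> 0)"
  proof (rule diagH)
    fix h assume h: "h \<in> carrier H"
    show "\<forall>\<^sub>F P in F. h \<noteq> \<one>\<^bsub>H\<^esub> \<longrightarrow> (\<exists>\<phi>\<in>Inr -` P. \<phi> h \<noteq> 0)"
    proof (cases "h = \<one>\<^bsub>H\<^esub>")
      case False
      then obtain \<phi> where \<phi>: "\<phi> \<in> carrier (dual H)" "\<phi> h \<noteq> 0"
        using reflexive_separates[OF assms(1,2) h] by blast
      from fineD[OF \<phi>(1)] show ?thesis
        by eventually_elim (use \<phi>(2) in blast)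
    qed simp
  qed
  define agree where "agree P h y \<longleftrightarrow> (\<forall>\<phi>\<in>Inr -` P. \<phi> h = \<phi> y)"
    for P :: "('a + ('a \<Rightarrow> int)) set" and h y
  have rep: "\<forall>\<^sub>F P in F. \<forall>y\<in>carrier H. \<exists>h\<in>Inl -` P. agree P h y"
  proof (rule ccontr)
    assume "\<not> ?thesis"
    from normal_measure_ultra[OF F this]
    have "\<forall>\<^sub>F P in F. \<exists>y. y \<in> carrier H \<and> (\<forall>h\<in>Inl -` P. \<not> agree P h y)"
      by eventually_elim blast
    then obtain y where
      y: "\<forall>\<^sub>F P in F. y P \<in> carrier H \<and> (\<forall>h\<in>Inl -` P. \<not> agree P h (y P))"
      by (rule eventually_choice)
    \<comment> \<open>The integer \<phi>(y P) is almost everywhere constant in P. Taking v on all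
      functions, not only homomorphisms, avoids membership conditions.\<close>
    have "\<exists>v. \<forall>\<phi> :: 'a \<Rightarrow> int. \<forall>\<^sub>F P in F. \<phi> (y P) = v \<phi>"
      by (intro choice allI normal_measure_countable_const[OF F assms(3)])
    then obtain v where v: "\<forall>\<^sub>F P in F. \<phi> (y P) = v \<phi>" for \<phi> :: "'a \<Rightarrow> int"
      by blast
    have "v (\<phi> \<otimes>\<^bsub>dual H\<^esub> \<psi>) = v \<phi> + v \<psi>" for \<phi> \<psi>
    proof -
      \<comment> \<open>Additivity is read off at any P where the three constant values are attained
        and y P lies in H.\<close>
      have "\<forall>\<^sub>F P in F. v (\<phi> \<otimes>\<^bsub>dual H\<^esub> \<psi>) = v \<phi> + v \<psi>"
        using y v[of \<phi>] v[of \<psi>] v[of "\<phi> \<otimes>\<^bsub>dual H\<^esub> \<psi>"]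
        by eventually_elim (auto simp: dual_def)
      then show ?thesis
        using normal_measure_neq_bot[OF F] by simp
    qed
    then obtain h where h: "h \<in> carrier H" "\<forall>\<phi>\<in>carrier (dual H). \<phi> h = v \<phi>"
      using reflexive_represents[OF assms(1,2), of v] by blast
    \<comment> \<open>For each fixed \<phi> both sides are v \<phi> almost everywhere; the diagonal
      intersection handles all \<phi> in P together. As h itself lies in almost every P, this
      contradicts the choice of y.\<close>
    have "\<forall>\<^sub>F P in F. agree P h (y P)"
      unfolding agree_def
    proof (rule diagD)
      fix \<phi> assume \<phi>: "\<phi> \<in> carrier (dual H)"
      from v[of \<phi>] show "\<forall>\<^sub>F P in F. \<phi> h = \<phi> (y P)"
        by eventually_elim (simp only: bspec[OF h(2) \<phi>])
    qed
    with y fineH[OF h(1)] have "\<forall>\<^sub>F P in F. False"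
      by eventually_elim blast
    then show False
      using normal_measure_neq_bot[OF F] by (simp add: eventually_False)
  qed
  show ?thesis
    using sub fineH[OF one_closed] mult inv sep rep
  proof eventually_elim
    case (elim P)
    then have "subgroup (Inl -` P) H"
      by (intro subgroupI) auto
    moreover have "Inr -` P \<subseteq> hom H integer_group"
      using elim(1) by (auto simp: dual_def)
    ultimately show ?case
      using elim(5,6) unfolding agree_def
      by (intro direct_summand_of_homs[OF assms(1), where \<Phi> = "Inr -` P"]) blast+
  qed
qed

theorem corollary3p2:
  fixes \<kappa> :: "'k rel" and H :: "('a, 'b) monoid_scheme" and \<chi> :: "'c rel"
  assumes "set_universe TYPE('v)"
    and "supercompact TYPE('v) \<kappa>"
    and "comm_group H" and "small TYPE('v) (carrier H)"
    and "reflexive H"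
    and "\<kappa> \<le>o |carrier H|"
    and "Card_order \<chi>" and "\<chi> <o \<kappa>"
  shows "\<exists>S. direct_summand S H \<and> \<chi> \<le>o |S| \<and> |S| <o \<kappa>"
proof -
  interpret comm_group H by fact
  \<comment> \<open>The dual is included so that P also selects the homomorphisms whose kernel is
    the complement.\<close>
  let ?A = "carrier H <+> carrier (dual H)"
  have \<kappa>: "natLeq <o \<kappa>"
    using assms(2) by (simp add: supercompact_def)
  then have "natLeq \<le>o |carrier H|"
    using assms(6) by (meson ordLess_imp_ordLeq ordLeq_transitive)
  then have inf: "infinite (carrier H)"
    using infinite_iff_natLeq_ordLeq by blast
  have "|?A| \<le>o |Pow (carrier H)|"
    using inf card_carrier_dual[OF inf] card_of_Pow[THEN ordLess_imp_ordLeq] card_of_Card_order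
    by (intro card_of_Plus_ordLeq_infinite_Field) (simp_all add: Field_card_of)
  then have "small TYPE('v) ?A"
    using small_Pow[OF assms(1,4)] by (rule small_mono)
  moreover have "\<kappa> \<le>o |?A|"
    using assms(6) card_of_Plus1 by (rule ordLeq_transitive)
  ultimately obtain F where F: "normal_measure \<kappa> ?A F"
    using supercompact_normal_measure[OF assms(2)] by blast
  have "\<chi> =o |Field \<chi>|"
    using card_of_Field_ordIso[OF assms(7)] by (rule ordIso_symmetric)
  moreover from this have "|Field \<chi>| \<le>o |carrier H|"
    using assms(6,8) by (meson ordIso_ordLeq_trans ordIso_symmetric ordLess_imp_ordLeq ordLeq_transitive)
  \<comment> \<open>X is a copy of \<chi> inside H. Being smaller than \<kappa>, it is contained in
    almost every P by fineness and completeness, which gives the lower bound on the summand.\<close>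
  then obtain X where X: "X \<subseteq> carrier H" "|Field \<chi>| =o |X|"
    using internalize_card_of_ordLeq2 by blast
  ultimately have \<chi>: "\<chi> =o |X|"
    by (blast intro: ordIso_transitive)
  then have "|X| <o \<kappa>"
    using assms(8) by (meson ordIso_ordLess_trans ordIso_symmetric)
  then have "\<forall>\<^sub>F P in F. \<forall>x\<in>X. Inl x \<in> P"
    using X(1) by (intro normal_measure_complete[OF F] normal_measure_fine[OF F]) auto
  with normal_measure_reflexive_summand[OF is_group assms(5) \<kappa> F] normal_measure_Pow_less[OF F]
  have "\<forall>\<^sub>F P in F. direct_summand (Inl -` P) H \<and> P \<in> Pow_less \<kappa> ?A \<and> X \<subseteq> Inl -` P"
    by eventually_elim auto
  from eventually_happens'[OF normal_measure_neq_bot[OF F] this]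
  obtain P where P: "direct_summand (Inl -` P) H" "P \<in> Pow_less \<kappa> ?A" "X \<subseteq> Inl -` P"
    by blast
  have "\<chi> \<le>o |Inl -` P|"
    using \<chi> card_of_mono1[OF P(3)] by (rule ordIso_ordLeq_trans)
  moreover have "|Inl -` P| \<le>o |P|"
    by (rule card_of_ordLeqI[of Inl]) auto
  then have "|Inl -` P| <o \<kappa>"
    using P(2) ordLeq_ordLess_trans by (auto simp: Pow_less_def)
  ultimately show ?thesis
    using P(1) by blast
qed

end
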